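(* Let $(\mathbb{K},|\cdot|)$ be a complete non-Archimedean valued field with nontrivial absolute value, $(X,\|\cdot\|)$ an ultrametric Banach space over $\mathbb{K}$, and $(X,\{A_n\})$ an ultrametric approximation scheme such that each $A_n$ is a closed linear subspace of $X$. Then $\inf_{n\in\mathbb{N}}E(B(X),A_n)\ge p_{\mathbb{K}}>0$.
   Context: $p_{\mathbb{K}}=\sup\{|\lambda|:\lambda\in\mathbb{K},|\lambda|<1\}$. An ultrametric approximation scheme $(X,\{A_n\})$ consists of an infinite chain $\{0\}=A_0\subset A_1\subset\cdots\subset X$ of subsets with all inclusions strict, such that: (i) there is a map $K:\mathbb{N}\to\mathbb{N}$ with $K(n)\ge n$ and $A_n+A_n\subseteq A_{K(n)}$ for all $n$; (ii) $\lambda A_n\subseteq A_n$ for all $n$ and $\lambda\in\mathbb{K}$; (iii) $\bigcup_n A_n$ is dense in $X$. $E(x,A)=\inf_{a\in A}\|x-a\|$, $E(B,A)=\sup_{b\in B}E(b,A)$, $B(X)=\{x\in X:\|x\|\le1\}$. *)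

theory Defs
  imports "HOL-Analysis.Abstract_Metric_Spaces"
begin

locale nonarch_valued_field =
  fixes vabs :: "'k::field \<Rightarrow> real"
  assumes vabs_nonneg: "0 \<le> vabs c"
    and vabs_eq_0_iff: "vabs c = 0 \<longleftrightarrow> c = 0"
    and vabs_mult: "vabs (c * d) = vabs c * vabs d"
    and vabs_ultra: "vabs (c + d) \<le> max (vabs c) (vabs d)"
begin

lemma vabs_one: "vabs 1 = 1"
  using vabs_mult[of 1 1] vabs_eq_0_iff[of 1] by simp

lemma vabs_minus_one: "vabs (- 1) = 1"
proof -
  have "(vabs (- 1))\<^sup>2 = 1"
    using vabs_mult[of "- 1" "- 1"] vabs_one by (simp add: power2_eq_square)
  then show ?thesis
    using vabs_nonneg[of "- 1"] by (auto simp: power2_eq_1_iff)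
qed

lemma vabs_minus: "vabs (- c) = vabs c"
  using vabs_mult[of "- 1" c] vabs_minus_one by simp

sublocale field_metric: Metric_space UNIV "\<lambda>a b. vabs (a - b)"
proof
  fix x y z :: 'k
  show "0 \<le> vabs (x - y)" by (rule vabs_nonneg)
  show "vabs (x - y) = vabs (y - x)" using vabs_minus[of "x - y"] by simp
  show "vabs (x - y) = 0 \<longleftrightarrow> x = y" by (simp add: vabs_eq_0_iff)
  show "vabs (x - z) \<le> vabs (x - y) + vabs (y - z)"
    using vabs_ultra[of "x - y" "y - z"] vabs_nonneg[of "x - y"] vabs_nonneg[of "y - z"]
    by simp
qed

definition nontrivial :: bool
  where "nontrivial \<longleftrightarrow> (\<exists>c. c \<noteq> 0 \<and> vabs c \<noteq> 1)"

definition p_const :: real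
  where "p_const = Sup {vabs c |c. vabs c < 1}"

end

locale complete_nonarch_valued_field = nonarch_valued_field +
  assumes complete: "field_metric.mcomplete"

locale ultrametric_normed_space = nonarch_valued_field vabs + vector_space scale
  for vabs :: "'k::field \<Rightarrow> real"
    and scale :: "'k \<Rightarrow> 'x::ab_group_add \<Rightarrow> 'x" +
  fixes nrm :: "'x \<Rightarrow> real"
  assumes nrm_nonneg: "0 \<le> nrm x"
    and nrm_eq_0_iff: "nrm x = 0 \<longleftrightarrow> x = 0"
    and nrm_scale: "nrm (scale c x) = vabs c * nrm x"
    and nrm_ultra: "nrm (x + y) \<le> max (nrm x) (nrm y)"
begin

lemma nrm_minus: "nrm (- x) = nrm x"
  using nrm_scale[of "- 1" x] vabs_minus_one by simp

sublocale norm_metric: Metric_space UNIV "\<lambda>x y. nrm (x - y)"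
proof
  fix x y z :: 'x
  show "0 \<le> nrm (x - y)" by (rule nrm_nonneg)
  show "nrm (x - y) = nrm (y - x)" using nrm_minus[of "x - y"] by simp
  show "nrm (x - y) = 0 \<longleftrightarrow> x = y" by (simp add: nrm_eq_0_iff)
  show "nrm (x - z) \<le> nrm (x - y) + nrm (y - z)"
    using nrm_ultra[of "x - y" "y - z"] nrm_nonneg[of "x - y"] nrm_nonneg[of "y - z"]
    by simp
qed

abbreviation norm_topology :: "'x topology"
  where "norm_topology \<equiv> norm_metric.mtopology"

definition approximation_scheme :: "(nat \<Rightarrow> 'x set) \<Rightarrow> bool"
  where "approximation_scheme A \<longleftrightarrow>
    A 0 = {0} \<and> (\<forall>n. A n \<subset> A (Suc n)) \<and> (\<forall>n. A n \<subset> UNIV) \<and>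
    (\<exists>K :: nat \<Rightarrow> nat. \<forall>n. n \<le> K n \<and> (\<forall>a\<in>A n. \<forall>b\<in>A n. a + b \<in> A (K n))) \<and>
    (\<forall>n c. scale c ` A n \<subseteq> A n) \<and>
    norm_topology closure_of (\<Union>n. A n) = UNIV"

text \<open>Suprema and infima are taken in the reals. Where \<open>0 \<in> A\<close> one has
  \<open>0 \<le> approx_error x A \<le> nrm x\<close>, so on nonempty norm-bounded sets all of them
  are over nonempty bounded sets.\<close>

definition approx_error :: "'x \<Rightarrow> 'x set \<Rightarrow> real"
  where "approx_error x A = (INF a\<in>A. nrm (x - a))"

definition set_approx_error :: "'x set \<Rightarrow> 'x set \<Rightarrow> real"
  where "set_approx_error B A = (SUP b\<in>B. approx_error b A)"

definition closed_unit_ball :: "'x set"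
  where "closed_unit_ball = {x. nrm x \<le> 1}"

end

locale ultrametric_Banach_space = ultrametric_normed_space +
  assumes complete: "norm_metric.mcomplete"

end

theory Submission
  imports Defs
begin

text \<open>A variant of Riesz's lemma. Given \<open>0 < q < p\<close>, pick a scalar \<open>\<mu>\<close> with \<open>q < |\<mu>| < 1\<close>.
  For \<open>x\<close> outside the closed subspace \<open>A\<close>, some \<open>y \<in> x + A\<close> has norm below \<open>|\<mu>|/q\<close> times the
  distance of \<open>x\<close> to \<open>A\<close>. Multiplying \<open>y\<close> by a suitable power of \<open>\<mu>\<close> brings its norm into the
  interval from \<open>|\<mu>|\<close> to \<open>1\<close>, and the resulting vector of the unit ball has distance at least \<open>q\<close>
  to \<open>A\<close>.\<close>

context nonarch_valued_field
begin

lemma vabs_pos_iff: "0 < vabs c \<longleftrightarrow> c \<noteq> 0"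
  using vabs_nonneg[of c] vabs_eq_0_iff[of c] by auto

lemma vabs_power: "vabs (c ^ n) = vabs c ^ n"
  by (induction n) (simp_all add: vabs_one vabs_mult)

lemma vabs_inverse: "vabs (inverse c) = inverse (vabs c)"
proof (cases "c = 0")
  case True
  then show ?thesis using vabs_eq_0_iff[of 0] by simp
next
  case False
  then have "vabs c * vabs (inverse c) = 1"
    using vabs_mult[of c "inverse c"] by (simp add: vabs_one)
  then show ?thesis by (rule inverse_unique[symmetric])
qed

lemma bdd_above_vabs_less_1: "bdd_above {vabs c |c. vabs c < 1}"
  by (rule bdd_aboveI[of _ 1]) auto

lemma p_const_upper: "vabs c < 1 \<Longrightarrow> vabs c \<le> p_const"
  unfolding p_const_def by (rule cSup_upper[OF _ bdd_above_vabs_less_1]) auto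

text \<open>Nontriviality supplies a nonzero scalar of absolute value other than 1; either it or its
  inverse has absolute value strictly between 0 and 1.\<close>

lemma p_const_pos:
  assumes nontrivial
  shows "0 < p_const"
proof -
  obtain c where c: "c \<noteq> 0" "vabs c \<noteq> 1"
    using assms unfolding nontrivial_def by blast
  obtain d where "d \<noteq> 0" "vabs d < 1"
  proof (cases "vabs c < 1")
    case True
    with c that show ?thesis by blast
  next
    case False
    with c have "vabs (inverse c) < 1"
      by (simp add: vabs_inverse inverse_less_1_iff)
    with c that[of "inverse c"] show ?thesis by simp
  qed
  then show ?thesis
    using p_const_upper[of d] vabs_pos_iff[of d] by linarith
qed

lemma less_p_constE:
  assumes "q < p_const"
  obtains m where "q < vabs m" "vabs m < 1"
proof -
  have "vabs 0 < 1"
    using vabs_eq_0_iff[of 0] by simp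
  then have "{vabs c |c. vabs c < 1} \<noteq> {}" by blast
  then show ?thesis
    using assms that less_cSupD[of "{vabs c |c. vabs c < 1}" q]
    unfolding p_const_def by blast
qed

text \<open>A power of \<open>inverse m\<close> first pushes \<open>t\<close> above 1; then
  multiplication by \<open>m\<close> is repeated until the value first drops to at most 1. The last
  step shrinks it only by the factor \<open>vabs m\<close>, so it stays above
  \<open>vabs m\<close>.\<close>

lemma exists_vabs_mult_bounds:
  assumes m: "m \<noteq> 0" "vabs m < 1" and t: "0 < t"
  obtains c where "c \<noteq> 0" "vabs c * t \<le> 1" "vabs m < vabs c * t"
proof -
  have m0: "0 < vabs m"
    using m by (simp add: vabs_pos_iff)
  with m have "1 < inverse (vabs m)"
    by (simp add: one_less_inverse_iff)
  then obtain M where M: "1 / t < inverse (vabs m) ^ M"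
    using real_arch_pow by blast
  define u where "u = inverse (vabs m) ^ M * t"
  have u: "1 < u"
    using M t by (simp add: u_def field_simps)
  obtain N where N: "vabs m ^ N < 1 / u"
    using real_arch_pow_inv[of "1 / u" "vabs m"] u m by auto
  define n where "n = (LEAST n. vabs m ^ n * u \<le> 1)"
  have "vabs m ^ N * u \<le> 1"
    using N u by (simp add: field_simps)
  then have le: "vabs m ^ n * u \<le> 1"
    unfolding n_def by (rule LeastI)
  \<comment> \<open>Since \<open>1 < u\<close>, the exponent 0 fails the bound, so \<open>n\<close>
    has a predecessor, which fails it too by minimality.\<close>
  with u obtain k where k: "n = Suc k"
    by (cases n) auto
  have "1 < vabs m ^ k * u"
    using not_less_Least[of k "\<lambda>n. vabs m ^ n * u \<le> 1"] k by (auto simp: n_def)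
  then have gt: "vabs m < vabs m ^ n * u"
    using m0 k by simp
  show ?thesis
    using that[of "m ^ n * inverse m ^ M"] m le gt
    by (simp add: vabs_mult vabs_power vabs_inverse u_def mult.assoc)
qed

end

context ultrametric_normed_space
begin

lemma bdd_below_nrm_diff: "bdd_below ((\<lambda>a. nrm (x - a)) ` A)"
  by (rule bdd_belowI[of _ 0]) (auto simp: nrm_nonneg)

lemma approx_error_lower: "a \<in> A \<Longrightarrow> approx_error x A \<le> nrm (x - a)"
  unfolding approx_error_def by (rule cINF_lower[OF bdd_below_nrm_diff])

lemma approx_error_pos:
  assumes "closedin norm_topology A" "A \<noteq> {}" "x \<notin> A"
  shows "0 < approx_error x A"
proof -
  obtain r where r: "0 < r" "disjnt A (norm_metric.mball x r)"
    using assms(1,3) unfolding norm_metric.closedin_metric by blast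
  have "r \<le> nrm (x - a)" if "a \<in> A" for a
  proof -
    have "a \<notin> norm_metric.mball x r"
      using r(2) that unfolding disjnt_iff by blast
    then show ?thesis
      unfolding norm_metric.in_mball by simp
  qed
  then have "r \<le> approx_error x A"
    unfolding approx_error_def by (rule cINF_greatest[OF assms(2)])
  with r show ?thesis by simp
qed

text \<open>For nonzero \<open>c\<close>, the point \<open>a\<close> of \<open>A\<close> is matched
  with \<open>b + scale (inverse c) a\<close>, again in \<open>A\<close>, and \<open>c\<close>
  factors out of the norm.\<close>

lemma approx_error_affine:
  assumes A: "subspace A" and "b \<in> A"
  shows "vabs c * approx_error x A \<le> approx_error (scale c (x - b)) A"
  unfolding approx_error_def[of "scale c (x - b)"]
proof (rule cINF_greatest)
  show "A \<noteq> {}" using assms by auto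
next
  fix a assume a: "a \<in> A"
  show "vabs c * approx_error x A \<le> nrm (scale c (x - b) - a)"
  proof (cases "c = 0")
    case True
    then show ?thesis using nrm_nonneg vabs_eq_0_iff[of 0] by simp
  next
    case False
    have "b + scale (inverse c) a \<in> A"
      using assms a by (intro subspace_add subspace_scale)
    then have "vabs c * approx_error x A \<le> nrm (scale c (x - (b + scale (inverse c) a)))"
      by (simp add: nrm_scale approx_error_lower mult_left_mono vabs_nonneg)
    also have "scale c (x - (b + scale (inverse c) a)) = scale c (x - b) - a"
      using False by (simp add: scale_right_diff_distrib scale_right_distrib)
    finally show ?thesis .
  qed
qed

text \<open>Comparing with the point 0 of \<open>A\<close> bounds all errors on the unit ball by 1,
  so the real supremum is a genuine upper bound.\<close>

lemma approx_error_le_set_approx_error: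
  assumes "0 \<in> A" "y \<in> closed_unit_ball"
  shows "approx_error y A \<le> set_approx_error closed_unit_ball A"
  unfolding set_approx_error_def
proof (rule cSUP_upper[OF assms(2)])
  have "approx_error b A \<le> 1" if "b \<in> closed_unit_ball" for b
    using approx_error_lower[OF assms(1), of b] that by (simp add: closed_unit_ball_def)
  then show "bdd_above ((\<lambda>b. approx_error b A) ` closed_unit_ball)"
    by (intro bdd_aboveI2)
qed

lemma p_const_le_set_approx_error:
  assumes nontrivial and A: "subspace A" "closedin norm_topology A" and x: "x \<notin> A"
  shows "p_const \<le> set_approx_error closed_unit_ball A"
\<comment> \<open>The supremum \<open>p_const\<close> need not be attained, so the bound is proved
  for every \<open>q\<close> strictly between 0 and \<open>p_const\<close>.\<close>
proof (rule dense_le_bounded[OF p_const_pos[OF assms(1)]])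
  fix q assume q: "0 < q" "q < p_const"
  obtain m where m: "q < vabs m" "vabs m < 1"
    using less_p_constE q(2) by blast
  have m0: "m \<noteq> 0"
    using m q vabs_pos_iff[of m] by linarith
  have A0: "0 \<in> A" using A(1) by (rule subspace_0)
  define d where "d = approx_error x A"
  have d: "0 < d"
    unfolding d_def using A(2) x A0 by (intro approx_error_pos) auto
  \<comment> \<open>The factor \<open>vabs m / q\<close> exceeds 1, so the right side lies above the
    infimum \<open>d\<close> and some point of \<open>A\<close> comes closer to \<open>x\<close>
    than that.\<close>
  then have "d < d * vabs m / q"
    using m q by (simp add: field_simps)
  then obtain b where b: "b \<in> A" "nrm (x - b) < d * vabs m / q"
    using A0 cINF_less_iff[OF _ bdd_below_nrm_diff, of A]
    unfolding d_def approx_error_def by blast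
  have "0 < nrm (x - b)"
    using x b nrm_nonneg[of "x - b"] nrm_eq_0_iff[of "x - b"] by auto
  then obtain c where c: "c \<noteq> 0" "vabs c * nrm (x - b) \<le> 1" "vabs m < vabs c * nrm (x - b)"
    using exists_vabs_mult_bounds m0 m(2) by blast
  note c(3)
  also have "vabs c * nrm (x - b) < vabs c * (d * vabs m / q)"
    using b(2) c(1) by (intro mult_strict_left_mono) (simp_all add: vabs_pos_iff)
  finally have "vabs m * q < vabs m * (vabs c * d)"
    using q by (simp add: field_simps)
  then have "q \<le> vabs c * d"
    using m0 by (simp add: vabs_pos_iff)
  also have "\<dots> \<le> approx_error (scale c (x - b)) A"
    unfolding d_def by (rule approx_error_affine[OF A(1) b(1)])
  also have "\<dots> \<le> set_approx_error closed_unit_ball A"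
    using A0 c by (intro approx_error_le_set_approx_error) (simp_all add: closed_unit_ball_def nrm_scale)
  finally show "q \<le> set_approx_error closed_unit_ball A" .
qed

end

theorem theorem2p6:
  fixes vabs :: "'k::field \<Rightarrow> real"
    and scale :: "'k \<Rightarrow> 'x::ab_group_add \<Rightarrow> 'x"
    and nrm :: "'x \<Rightarrow> real"
    and A :: "nat \<Rightarrow> 'x set"
  assumes "complete_nonarch_valued_field vabs"
    and "nonarch_valued_field.nontrivial vabs"
    and "ultrametric_Banach_space vabs scale nrm"
    and "ultrametric_normed_space.approximation_scheme scale nrm A"
    and "\<And>n. module.subspace scale (A n)"
    and "\<And>n. closedin (Metric_space.mtopology UNIV (\<lambda>x y. nrm (x - y))) (A n)"
  shows "(INF n. ultrametric_normed_space.set_approx_error nrm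
                   (ultrametric_normed_space.closed_unit_ball nrm) (A n))
           \<ge> nonarch_valued_field.p_const vabs
       \<and> nonarch_valued_field.p_const vabs > 0"
proof -
  interpret ultrametric_Banach_space vabs scale nrm by fact
  have "p_const \<le> (INF n. set_approx_error closed_unit_ball (A n))"
  proof (rule cINF_greatest)
    fix n
    \<comment> \<open>Properness of the subspace is all that is drawn from the scheme: it yields a
      vector outside \<open>A n\<close>.\<close>
    have "A n \<subset> UNIV"
      using assms(4) by (simp add: approximation_scheme_def)
    then obtain x where "x \<notin> A n" by auto
    with assms(2,5,6) show "p_const \<le> set_approx_error closed_unit_ball (A n)"
      by (rule p_const_le_set_approx_error)
  qed simp
  with p_const_pos[OF assms(2)] show ?thesis by (rule conjI[rotated])
qed

end
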